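(* Let $K$ be a martingale kernel on $(0,\infty)$ and, for $x>0$, let $S=(S_k)_{k\in\mathbb{N}_0}$ be under $\mathbb{P}_x$ the positive Markov martingale with transition kernel $K$ started from $S_0=x$. Let $a(x):=\mathbb{P}_x[S_1<x]=K(x,(0,x))$ and suppose that for every $x_a>0$ and every $y>x_a$ one has $\inf_{x\in[x_a,y]}a(x)>0$. Let $M:(0,\infty)\to[0,\infty)$ be Borel-measurable with $M(x)\le x$ for all $x>0$ and $$M(x)\le\int_{[x,\infty)}M(y)\,K(x,\mathrm{d}y),\quad x>0.$$ Then $M\le M_S$, where $M_S$ is the default function of $S$. If in addition $\liminf_{x\to\infty}M(x)>0$, then $S$ is a bubble under $\mathbb{P}_x$ for all $x>0$ for which $S$ is not $\mathbb{P}_x$-a.s. bounded.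
   Context: Martingale kernel: $K:(0,\infty)\times\mathcal{B}_{(0,\infty)}\to[0,\infty)$ is a Markov (probability) kernel on $(0,\infty)$ with $\int_{(0,\infty)}y\,K(x,\mathrm{d}y)=x$ for all $x>0$. For $x>0$, under $\mathbb{P}_x$ (with expectation $\mathbb{E}_x$) the process $S=(S_k)_{k\in\mathbb{N}_0}$ is the time-homogeneous Markov chain with $S_0=x$ and transition kernel $K$; it is a positive martingale, with $\mathbb{P}_x$-a.s. limit $S_\infty$. "$S$ is $\mathbb{P}_x$-a.s. bounded" means that there is a deterministic constant $C<\infty$ with $\mathbb{P}_x[S_k\le C \text{ for all } k\in\mathbb{N}_0]=1$. Default function: $M_S:(0,\infty)\to[0,\infty)$, $M_S(x):=\lim_{n\to\infty}\mathbb{E}_x\big[(S_n-S_\infty)\mathbf{1}_{\{S_n\ge S_{n-1}\ge\dots\ge S_1\ge x\}}\big]$. Definition (bubble): put $\tau_0:=0$ and $\tau_k:=\inf\{j>\tau_{k-1}: S_j<S_{j-1}\}$ for $k\in\mathbb{N}$ ($\inf\emptyset=\infty$), and $S_{\tau_k}:=S_\infty$ on $\{\tau_k=\infty\}$. $S$ is a bubble under $\mathbb{P}_x$ (equivalently $\mathbb{P}_x$ is a bubble measure for $S$) if $\mathbb{E}_x[S_{\tau_k}]<\mathbb{E}_x[S_0]=x$ for some $k\in\mathbb{N}$. *)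

theory Defs
  imports "HOL-Probability.Probability"
begin

definition pos_borel :: "real measure" where
  "pos_borel = restrict_space borel {0<..}"

definition martingale_kernel :: "(real \<Rightarrow> real measure) \<Rightarrow> bool" where
  "martingale_kernel K \<longleftrightarrow>
     K \<in> pos_borel \<rightarrow>\<^sub>M prob_algebra pos_borel \<and>
     (\<forall>x>0. (\<integral>\<^sup>+y. ennreal y \<partial>K x) = ennreal x)"

definition natural_filtration :: "'w measure \<Rightarrow> (nat \<Rightarrow> 'w \<Rightarrow> real) \<Rightarrow> nat \<Rightarrow> 'w measure" where
  "natural_filtration P S n =
     sigma (space P) {S i -` A \<inter> space P | i A. i \<le> n \<and> A \<in> sets pos_borel}"

text \<open>
  \<open>S\<close> is, under \<open>P\<close>, a time-homogeneous Markov chain on \<open>(0,\<infinity>)\<close> with transition kernel \<open>K\<close>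
  started at \<open>x\<close>. The underlying probability space is arbitrary; the Ionescu-Tulcea construction
  provides one in which \<open>S\<close> is the coordinate process (lemma \<open>markov_chain_from_exists\<close>).
\<close>
definition markov_chain_from ::
  "(real \<Rightarrow> real measure) \<Rightarrow> real \<Rightarrow> 'w measure \<Rightarrow> (nat \<Rightarrow> 'w \<Rightarrow> real) \<Rightarrow> bool" where
  "markov_chain_from K x P S \<longleftrightarrow>
     prob_space P \<and>
     (\<forall>k. S k \<in> P \<rightarrow>\<^sub>M pos_borel) \<and>
     (AE \<omega> in P. S 0 \<omega> = x) \<and>
     (\<forall>n. \<forall>A\<in>sets pos_borel.
        AE \<omega> in P.
          real_cond_exp P (natural_filtration P S n) (indicator (S (Suc n) -` A \<inter> space P)) \<omega>
            = measure (K (S n \<omega>)) A)"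

text \<open>The value on the null set where \<open>S\<close> does not converge is irrelevant.\<close>
definition S_lim :: "(nat \<Rightarrow> 'w \<Rightarrow> real) \<Rightarrow> 'w \<Rightarrow> real" where
  "S_lim S \<omega> = lim (\<lambda>n. S n \<omega>)"

text \<open>
  From \<open>n = 1\<close> on, the expectations are nonnegative and nonincreasing in \<open>n\<close> (\<open>S\<close> is a positive
  martingale), so \<open>lim\<close> is a genuine limit.
\<close>
definition default_fun :: "(real \<Rightarrow> 'w measure) \<Rightarrow> (nat \<Rightarrow> 'w \<Rightarrow> real) \<Rightarrow> real \<Rightarrow> real" where
  "default_fun P S x = lim (\<lambda>n.
     \<integral>\<omega>. (S n \<omega> - S_lim S \<omega>) *
          indicator {\<omega>. x \<le> S 1 \<omega> \<and> (\<forall>i\<in>{1..<n}. S i \<omega> \<le> S (Suc i) \<omega>)} \<omega> \<partial>P x)"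

text \<open>
  The stopping times \<open>\<tau>\<^sub>k\<close> of the definition of a bubble. On \<^typ>\<open>enat\<close>, the infimum of the empty
  set is \<open>\<infinity>\<close>; the condition on \<open>j\<close> forces \<open>j \<ge> 1\<close>, so \<open>j - 1\<close> does not truncate.
\<close>
fun downtick :: "(nat \<Rightarrow> 'w \<Rightarrow> real) \<Rightarrow> nat \<Rightarrow> 'w \<Rightarrow> enat" where
  "downtick S 0 \<omega> = 0"
| "downtick S (Suc k) \<omega> = Inf {enat j | j. downtick S k \<omega> < enat j \<and> S j \<omega> < S (j - 1) \<omega>}"

definition stopped_value :: "(nat \<Rightarrow> 'w \<Rightarrow> real) \<Rightarrow> ('w \<Rightarrow> enat) \<Rightarrow> 'w \<Rightarrow> real" where
  "stopped_value S T \<omega> = (case T \<omega> of enat j \<Rightarrow> S j \<omega> | \<infinity> \<Rightarrow> S_lim S \<omega>)"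

text \<open>
  The random variables here are nonnegative almost surely, and \<open>nn_integral\<close> (unlike the Bochner
  integral, which is 0 for non-integrable functions) needs no integrability side condition.
\<close>
definition bubble :: "'w measure \<Rightarrow> (nat \<Rightarrow> 'w \<Rightarrow> real) \<Rightarrow> real \<Rightarrow> bool" where
  "bubble P S x \<longleftrightarrow>
     (\<exists>k\<ge>1. (\<integral>\<^sup>+\<omega>. ennreal (stopped_value S (downtick S k) \<omega>) \<partial>P) < ennreal x)"

definition as_bounded :: "'w measure \<Rightarrow> (nat \<Rightarrow> 'w \<Rightarrow> real) \<Rightarrow> bool" where
  "as_bounded P S \<longleftrightarrow> (\<exists>C. AE \<omega> in P. \<forall>k. S k \<omega> \<le> C)"

lemma markov_chain_from_exists:
  assumes K: "martingale_kernel K" and x: "x > 0"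
  shows "\<exists>P :: (nat \<Rightarrow> real) measure. markov_chain_from K x P (\<lambda>k \<omega>. \<omega> k)"
proof -
  let ?E = pos_borel
  have spE: "space ?E = {0<..}" by (simp add: pos_borel_def space_restrict_space)
  have Kp: "K \<in> ?E \<rightarrow>\<^sub>M prob_algebra ?E" using K by (simp add: martingale_kernel_def)
  have Ks[measurable]: "K \<in> ?E \<rightarrow>\<^sub>M subprob_algebra ?E" by (rule measurable_prob_algebraD[OF Kp])
  have Kprob: "prob_space (K y)" "sets (K y) = sets ?E" if "y > 0" for y
    using measurable_space[OF Kp, of y] that by (auto simp: spE space_prob_algebra)
  define Q where "Q i \<omega> = (if i = 0 then return ?E x else K (\<omega> (i - 1)))"
    for i :: nat and \<omega> :: "nat \<Rightarrow> real"
  have xE: "x \<in> space ?E" using x by (simp add: spE)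
  interpret IT: Ionescu_Tulcea Q "\<lambda>_. ?E"
  proof (rule Ionescu_Tulcea.intro)
    show "Q i \<in> PiM {0..<i} (\<lambda>_. ?E) \<rightarrow>\<^sub>M subprob_algebra ?E" for i
    proof (cases i)
      case 0
      then show ?thesis using xE
        by (auto simp: Q_def[abs_def] intro!: measurable_const
            measurable_space[OF return_measurable])
    next
      case (Suc j)
      then have [measurable]: "(\<lambda>\<omega>. \<omega> j) \<in> PiM {0..<i} (\<lambda>_. ?E) \<rightarrow>\<^sub>M ?E"
        by (intro measurable_component_singleton) auto
      show ?thesis using Suc by (simp add: Q_def[abs_def])
    qed
    show "prob_space (Q i \<omega>)" if "\<omega> \<in> space (PiM {0..<i} (\<lambda>_. ?E))" for i \<omega>
    proof (cases i)
      case 0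
      then show ?thesis using xE by (simp add: Q_def prob_space_return)
    next
      case (Suc j)
      then have "\<omega> j > 0" using that by (auto simp: space_PiM PiE_iff spE)
      then show ?thesis using Suc Kprob by (simp add: Q_def)
    qed
  qed
  let ?L = "IT.PF.lim"
  let ?R = "\<lambda>n::nat. PiM {0..<n} (\<lambda>_. ?E)"
  let ?C = "\<lambda>n. IT.C 0 n (\<lambda>_. undefined)"
  have setsL[measurable_cong]: "sets ?L = sets (PiM UNIV (\<lambda>_. ?E))" by (rule IT.PF.sets_lim)
  have spL: "space ?L = space (PiM UNIV (\<lambda>_. ?E))" by (rule sets_eq_imp_space_eq[OF setsL])
  interpret L: prob_space ?L
  proof
    show "emeasure ?L (space ?L) = 1"
      using IT.lim[of "{}" "space (PiM {} (\<lambda>_. ?E))"]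
        sets.top[of "PiM {} (\<lambda>_. ?E)"] prob_space.emeasure_space_1[OF IT.PF.prob_space_P[of "{}"]]
      by (simp add: spL prod_emb_def space_PiM IT.PF.space_P restrict_def)
  qed
  have S[measurable]: "(\<lambda>\<omega>. \<omega> k) \<in> ?L \<rightarrow>\<^sub>M ?E" for k
    by (subst measurable_cong_sets[OF setsL refl]) (simp add: measurable_component_singleton)
  have restr[measurable]: "(\<lambda>\<omega>. restrict \<omega> {0..<n}) \<in> ?L \<rightarrow>\<^sub>M ?R n" for n
    by (rule measurable_restrict) (rule S)
  have u0: "(\<lambda>_. undefined) \<in> space (?R 0)" by (simp add: space_PiM)
  have setsC: "sets (?C n) = sets (?R n)" for n using IT.sets_C[OF u0, of n] by simp
  have upto: "IT.up_to {0..<n} = n" for n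
    using IT.up_to_iff_Ico[of "{0..<n}" n] IT.up_to[of "{0..<n}"] by (auto simp: ivl_subset)
  have distrL: "distr ?L (?R n) (\<lambda>\<omega>. restrict \<omega> {0..<n}) = ?C n" for n
  proof -
    have "distr ?L (?R n) (\<lambda>\<omega>. restrict \<omega> {0..<n}) = distr (?C n) (?R n) (\<lambda>f. restrict f {0..<n})"
      by (subst IT.distr_lim) (simp_all add: IT.CI_def upto)
    also have "\<dots> = ?C n"
      using IT.distr_C[of n n "\<lambda>_. undefined" 0] u0 by simp
    finally show ?thesis .
  qed
  have CSuc: "(\<integral>\<^sup>+\<omega>. f \<omega> \<partial>?C (Suc n)) = (\<integral>\<^sup>+\<omega>. (\<integral>\<^sup>+y. f (fun_upd \<omega> n y) \<partial>Q n \<omega>) \<partial>?C n)"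
    if f[measurable]: "f \<in> borel_measurable (?R (Suc n))" for f n
  proof -
    have "(\<integral>\<^sup>+\<omega>. f \<omega> \<partial>?C (Suc n)) = (\<integral>\<^sup>+\<omega>. (\<integral>\<^sup>+y. f y \<partial>IT.eP n \<omega>) \<partial>?C n)"
      using IT.measurable_eP[of n]
      by (simp, subst nn_integral_bind[where B="?R (Suc n)"])
         (auto simp: measurable_cong_sets[OF setsC refl] f)
    also have "\<dots> = (\<integral>\<^sup>+\<omega>. (\<integral>\<^sup>+y. f (fun_upd \<omega> n y) \<partial>Q n \<omega>) \<partial>?C n)"
      by (intro nn_integral_cong IT.nn_integral_eP f)
         (simp add: sets_eq_imp_space_eq[OF setsC])
    finally show ?thesis .
  qed
  have restr_nn: "(\<integral>\<^sup>+\<omega>. f (restrict \<omega> {0..<n}) \<partial>?L) = (\<integral>\<^sup>+\<omega>. f \<omega> \<partial>?C n)"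
    if "f \<in> borel_measurable (?R n)" for f n
    unfolding distrL[symmetric] using that by (subst nn_integral_distr) auto

  have start: "AE \<omega> in ?L. \<omega> 0 = x"
  proof -
    have sing: "{x} \<in> sets ?E"
      using x by (auto simp: pos_borel_def sets_restrict_space_iff)
    have c[measurable]: "(\<lambda>\<omega>. \<omega> 0) \<in> ?R (Suc 0) \<rightarrow>\<^sub>M ?E"
      by (rule measurable_component_singleton) simp
    let ?X = "(\<lambda>\<omega>. \<omega> 0) -` {x} \<inter> space ?L"
    have "emeasure ?L ?X = (\<integral>\<^sup>+\<omega>. indicator ?X \<omega> \<partial>?L)"
      by (rule nn_integral_indicator[symmetric]) (rule measurable_sets[OF S sing])
    also have "\<dots> = (\<integral>\<^sup>+\<omega>. indicator {x} (restrict \<omega> {0..<Suc 0} 0) \<partial>?L)"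
      by (intro nn_integral_cong) (auto split: split_indicator)
    also have "\<dots> = (\<integral>\<^sup>+\<omega>. indicator {x} (\<omega> 0) \<partial>?C (Suc 0))"
      by (rule restr_nn[of "\<lambda>\<omega>. indicator {x} (\<omega> 0)" "Suc 0"])
         (use sing in measurable)
    also have "\<dots> = (\<integral>\<^sup>+\<omega>. (\<integral>\<^sup>+y. indicator {x} y \<partial>return ?E x) \<partial>?C 0)"
      by (subst CSuc) (use sing in \<open>auto simp: Q_def\<close>)
    also have "\<dots> = (\<integral>\<^sup>+\<omega>. 1 \<partial>?C 0)"
      using sing xE by (subst nn_integral_return) auto
    also have "\<dots> = 1"
      using prob_space.emeasure_space_1[OF IT.prob_space_C[OF u0, of 0]] by simp
    finally have "L.prob ((\<lambda>\<omega>. \<omega> 0) -` {x} \<inter> space ?L) = 1"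
      by (simp add: measure_def)
    then show ?thesis
      by (subst (asm) L.prob_eq_1) (use measurable_sets[OF S sing, of 0] in auto)
  qed

  have markov: "AE \<omega> in ?L.
       real_cond_exp ?L (natural_filtration ?L (\<lambda>k \<omega>. \<omega> k) n) (indicator ((\<lambda>\<omega>. \<omega> (Suc n)) -` A \<inter> space ?L)) \<omega>
         = measure (K (\<omega> n)) A" if A[measurable]: "A \<in> sets ?E" for n A
  proof -
    let ?F = "natural_filtration ?L (\<lambda>k \<omega>. \<omega> k) n"
    let ?G = "{(\<lambda>\<omega>. \<omega> i) -` A \<inter> space ?L | i A. i \<le> n \<and> A \<in> sets ?E}"
    let ?V = "vimage_algebra (space ?L) (\<lambda>\<omega>. restrict \<omega> {0..<Suc n}) (?R (Suc n))"
    have G: "?G \<subseteq> Pow (space ?L)" by auto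
    have spF: "space ?F = space ?L"
      unfolding natural_filtration_def by (rule space_measure_of[OF G])
    have setsF: "sets ?F = sigma_sets (space ?L) ?G"
      unfolding natural_filtration_def by (rule sets_measure_of[OF G])
    have sub: "subalgebra ?L ?F"
      unfolding subalgebra_def spF setsF using measurable_sets[OF S]
      by (auto intro!: sets.sigma_sets_subset)
    have FV: "sets ?F \<subseteq> sets ?V"
    proof -
      have "?G \<subseteq> sets ?V"
      proof safe
        fix i B assume i: "i \<le> n" and B: "B \<in> sets ?E"
        have c: "(\<lambda>\<omega>. \<omega> i) \<in> ?R (Suc n) \<rightarrow>\<^sub>M ?E"
          by (rule measurable_component_singleton) (use i in simp)
        have "(\<lambda>\<omega>. restrict \<omega> {0..<Suc n}) -` ((\<lambda>\<omega>. \<omega> i) -` B \<inter> space (?R (Suc n))) \<inter> space ?L \<in> sets ?V"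
          by (rule in_vimage_algebra) (rule measurable_sets[OF c B])
        also have "(\<lambda>\<omega>. restrict \<omega> {0..<Suc n}) -` ((\<lambda>\<omega>. \<omega> i) -` B \<inter> space (?R (Suc n))) \<inter> space ?L
            = (\<lambda>\<omega>. \<omega> i) -` B \<inter> space ?L"
          using i by (auto simp: spL space_PiM PiE_iff)
        finally show "(\<lambda>\<omega>. \<omega> i) -` B \<inter> space ?L \<in> sets ?V" .
      qed
      then show ?thesis unfolding setsF using sets.sigma_sets_subset[of ?G ?V] by simp
    qed
    interpret sub: sigma_finite_subalgebra ?L ?F
      by (intro finite_measure_subalgebra_is_sigma_finite
          finite_measure_subalgebra.intro finite_measure_subalgebra_axioms.intro
          L.finite_measure_axioms sub)
    have mK: "(\<lambda>y. measure (K y) A) \<in> borel_measurable ?E"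
      by measurable
    have SnF: "(\<lambda>\<omega>. \<omega> n) \<in> ?F \<rightarrow>\<^sub>M ?E"
    proof (rule measurableI)
      show "\<omega> n \<in> space ?E" if "\<omega> \<in> space ?F" for \<omega>
        using that measurable_space[OF S, of \<omega> n] by (simp add: spF)
      show "(\<lambda>\<omega>. \<omega> n) -` B \<inter> space ?F \<in> sets ?F" if "B \<in> sets ?E" for B
        unfolding setsF spF using that by (intro sigma_sets.Basic) auto
    qed
    have mKF: "(\<lambda>\<omega>. measure (K (\<omega> n)) A) \<in> borel_measurable ?F"
      by (rule measurable_compose[OF SnF mK])
    have mKL: "(\<lambda>\<omega>. measure (K (\<omega> n)) A) \<in> borel_measurable ?L"
      by (rule measurable_compose[OF S mK])
    have posL: "\<omega> n > 0" if "\<omega> \<in> space ?L" for \<omega> n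
      using that measurable_space[OF S, of \<omega> n] by (simp add: spE)
    have le1: "measure (K (\<omega> n)) A \<le> 1" if "\<omega> \<in> space ?L" for \<omega>
      by (rule prob_space.prob_le_1[OF Kprob(1)[OF posL[OF that]]])
    let ?D = "(\<lambda>\<omega>. \<omega> (Suc n)) -` A \<inter> space ?L"
    have D: "?D \<in> sets ?L" by (rule measurable_sets[OF S A])
    show ?thesis
    proof (rule sub.real_cond_exp_charact)
      show "integrable ?L (\<lambda>\<omega>. indicator ?D \<omega> :: real)"
        using D by (simp add: less_top[symmetric])
      show int: "integrable ?L (\<lambda>\<omega>. measure (K (\<omega> n)) A)"
        by (rule L.integrable_const_bound[of _ 1]) (use le1 mKL in auto)
      show "(\<lambda>\<omega>. measure (K (\<omega> n)) A) \<in> borel_measurable ?F" by (rule mKF)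
      fix B assume B: "B \<in> sets ?F"
      then have BL: "B \<in> sets ?L" using sub by (auto simp: subalgebra_def)
      obtain B' where B'[measurable]: "B' \<in> sets (?R (Suc n))"
        and BB': "B = (\<lambda>\<omega>. restrict \<omega> {0..<Suc n}) -` B' \<inter> space ?L"
        using B FV measurable_space[OF restr[of "Suc n"]]
        by (auto simp: subset_iff sets_vimage_algebra2)
      have c[measurable]: "(\<lambda>\<omega>. \<omega> n) \<in> ?R (Suc n) \<rightarrow>\<^sub>M ?E"
        by (rule measurable_component_singleton) simp
      have c2[measurable]: "(\<lambda>\<omega>. \<omega> (Suc n)) \<in> ?R (Suc (Suc n)) \<rightarrow>\<^sub>M ?E"
        by (rule measurable_component_singleton) simp
      have c3[measurable]: "(\<lambda>\<omega>. restrict \<omega> {0..<Suc n}) \<in> ?R (Suc (Suc n)) \<rightarrow>\<^sub>M ?R (Suc n)"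
        by (rule measurable_restrict) (auto intro: measurable_component_singleton)
      let ?f = "\<lambda>\<omega>. indicator B' (restrict \<omega> {0..<Suc n}) * indicator A (\<omega> (Suc n)) :: ennreal"
      have rr: "restrict (restrict \<omega> {0..<Suc (Suc n)}) {0..<Suc n} = restrict \<omega> {0..<Suc n}"
        for \<omega> :: "nat \<Rightarrow> real" by (auto simp: restrict_def fun_eq_iff)
      have "emeasure ?L (B \<inter> ?D) = (\<integral>\<^sup>+\<omega>. indicator (B \<inter> ?D) \<omega> \<partial>?L)"
        by (rule nn_integral_indicator[symmetric]) (use BL D in auto)
      also have "\<dots> = (\<integral>\<^sup>+\<omega>. ?f (restrict \<omega> {0..<Suc (Suc n)}) \<partial>?L)"
        unfolding rr by (intro nn_integral_cong) (auto split: split_indicator simp: BB')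
      also have "\<dots> = (\<integral>\<^sup>+\<omega>. ?f \<omega> \<partial>?C (Suc (Suc n)))"
        by (rule restr_nn) measurable
      also have "\<dots> = (\<integral>\<^sup>+\<omega>. (\<integral>\<^sup>+y. ?f (fun_upd \<omega> (Suc n) y) \<partial>Q (Suc n) \<omega>) \<partial>?C (Suc n))"
        by (rule CSuc) measurable
      also have "\<dots> = (\<integral>\<^sup>+\<omega>. indicator B' \<omega> * ennreal (measure (K (\<omega> n)) A) \<partial>?C (Suc n))"
      proof (rule nn_integral_cong)
        fix \<omega> assume "\<omega> \<in> space (?C (Suc n))"
        then have w: "\<omega> \<in> space (?R (Suc n))" unfolding sets_eq_imp_space_eq[OF setsC] .
        then have "\<omega> n > 0" by (auto simp: space_PiM PiE_iff spE)
        note KK = Kprob[OF this]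
        have r: "restrict (fun_upd \<omega> (Suc n) y) {0..<Suc n} = \<omega>" for y
          using w by (auto simp: space_PiM PiE_iff extensional_def fun_eq_iff)
        have "(\<integral>\<^sup>+y. ?f (fun_upd \<omega> (Suc n) y) \<partial>Q (Suc n) \<omega>)
            = indicator B' \<omega> * (\<integral>\<^sup>+y. indicator A y \<partial>K (\<omega> n))"
          unfolding r using A KK(2) by (simp add: Q_def nn_integral_cmult_indicator)
        also have "(\<integral>\<^sup>+y. indicator A y \<partial>K (\<omega> n)) = ennreal (measure (K (\<omega> n)) A)"
          using A KK by (simp add: finite_measure.emeasure_eq_measure prob_space.finite_measure)
        finally show "(\<integral>\<^sup>+y. ?f (fun_upd \<omega> (Suc n) y) \<partial>Q (Suc n) \<omega>)
            = indicator B' \<omega> * ennreal (measure (K (\<omega> n)) A)" .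
      qed
      also have "\<dots> = (\<integral>\<^sup>+\<omega>. indicator B' (restrict \<omega> {0..<Suc n})
            * ennreal (measure (K (restrict \<omega> {0..<Suc n} n)) A) \<partial>?L)"
      proof (rule restr_nn[symmetric])
        have [measurable]: "(\<lambda>\<omega>. measure (K (\<omega> n)) A) \<in> borel_measurable (?R (Suc n))"
          by (rule measurable_compose[OF c mK])
        show "(\<lambda>\<omega>. indicator B' \<omega> * ennreal (measure (K (\<omega> n)) A)) \<in> borel_measurable (?R (Suc n))"
          by measurable
      qed
      also have "\<dots> = (\<integral>\<^sup>+\<omega>. ennreal (indicator B \<omega> * measure (K (\<omega> n)) A) \<partial>?L)"
        by (auto intro!: nn_integral_cong split: split_indicator simp: BB')
      also have "\<dots> = ennreal (\<integral>\<omega>. indicator B \<omega> * measure (K (\<omega> n)) A \<partial>?L)"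
        using integrable_mult_indicator[OF BL int]
        by (intro nn_integral_eq_integral) auto
      finally have "L.prob (B \<inter> ?D) = (\<integral>\<omega>. indicator B \<omega> * measure (K (\<omega> n)) A \<partial>?L)"
        by (simp add: L.emeasure_eq_measure integral_nonneg)
      moreover have "(\<integral>\<omega>\<in>B. indicator ?D \<omega> \<partial>?L) = L.prob (B \<inter> ?D)"
      proof -
        have "(\<integral>\<omega>\<in>B. indicator ?D \<omega> \<partial>?L) = (\<integral>\<omega>. indicator (B \<inter> ?D) \<omega> \<partial>?L)"
          unfolding set_lebesgue_integral_def
          by (intro Bochner_Integration.integral_cong) (auto split: split_indicator)
        also have "\<dots> = L.prob (B \<inter> ?D)"
          using BL D by (simp add: Int_assoc)
        finally show ?thesis .
      qed
      ultimately show "(\<integral>\<omega>\<in>B. indicator ?D \<omega> \<partial>?L) = (\<integral>\<omega>\<in>B. measure (K (\<omega> n)) A \<partial>?L)"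
        by (simp add: set_lebesgue_integral_def)
    qed
  qed
  have "markov_chain_from K x ?L (\<lambda>k \<omega>. \<omega> k)"
    unfolding markov_chain_from_def using L.prob_space_axioms S start markov by blast
  then show ?thesis by blast
qed

end

theory Submission
  imports Defs
begin

text \<open>
  The one-step inequality for \<open>M\<close>, iterated with the Markov property along nondecreasing stretches
  of the path, gives \<open>E[M(S\<^sub>n); B] \<le> E[S\<^sub>m; B, S\<^sub>n \<le> \<dots> \<le> S\<^sub>m]\<close> for every event \<open>B\<close> observable at time \<open>n\<close>.

  A nondecreasing path that does not tend to infinity stays in some compact interval
  \<open>[a, b] \<subseteq> (0,\<infinity>)\<close>, where each step goes down with probability bounded away from 0, while
  divergence to infinity is excluded by Fatou's lemma. So almost surely there are infinitely many
  downticks, the term with \<open>S\<^sub>\<infinity>\<close> in the default function vanishes in the limit, and \<open>M \<le> M\<^sub>S\<close> is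
  the case \<open>n = 0\<close> of the inequality.

  For the bubble property choose \<open>n\<close> and \<open>c\<close> such that \<open>B = {S\<^sub>n > C, exactly c downticks up to n}\<close>
  has positive probability, where \<open>M \<ge> d > 0\<close> beyond \<open>C\<close>. With \<open>k = c + 1\<close>, optional stopping gives
  \<open>E[S(\<tau>\<^sub>k); \<tau>\<^sub>k \<le> m] = x - E[S\<^sub>m; \<tau>\<^sub>k > m] \<le> x - d P(B)\<close> for all \<open>m \<ge> n\<close>.
\<close>

section \<open>The state space and the natural filtration\<close>

lemma space_pos_borel [simp]: "space pos_borel = {0<..}"
  by (simp add: pos_borel_def space_restrict_space)

lemma measurable_pos_borel_imp_borel: "f \<in> N \<rightarrow>\<^sub>M pos_borel \<Longrightarrow> f \<in> borel_measurable N"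
  unfolding pos_borel_def by (rule measurable_restrict_space2_iff[THEN iffD1, THEN conjunct1])

lemma borel_measurable_pos_borel [measurable]: "(\<lambda>y. y) \<in> borel_measurable pos_borel"
  by (rule measurable_pos_borel_imp_borel) simp

lemma space_natural_filtration [simp]: "space (natural_filtration P S n) = space P"
  unfolding natural_filtration_def by (rule space_measure_of) auto

lemma sets_natural_filtration:
  "sets (natural_filtration P S n) =
     sigma_sets (space P) {S i -` A \<inter> space P | i A. i \<le> n \<and> A \<in> sets pos_borel}"
  unfolding natural_filtration_def by (rule sets_measure_of) auto

lemma sets_natural_filtration_mono:
  "m \<le> n \<Longrightarrow> sets (natural_filtration P S m) \<subseteq> sets (natural_filtration P S n)"
  unfolding sets_natural_filtration by (rule sigma_sets_mono') fastforce

section \<open>The Markov property in integrated form\<close>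

locale markov_martingale = prob_space P
  for K :: "real \<Rightarrow> real measure" and x :: real and P :: "'w measure"
    and S :: "nat \<Rightarrow> 'w \<Rightarrow> real" +
  assumes x_pos: "x > 0"
    and kernel: "martingale_kernel K"
    and chain: "markov_chain_from K x P S"
begin

abbreviation F :: "nat \<Rightarrow> 'w measure" where "F \<equiv> natural_filtration P S"

lemma K_prob_algebra: "K \<in> pos_borel \<rightarrow>\<^sub>M prob_algebra pos_borel"
  using kernel by (simp add: martingale_kernel_def)

lemma K_subprob [measurable]: "K \<in> pos_borel \<rightarrow>\<^sub>M subprob_algebra pos_borel"
  by (rule measurable_prob_algebraD[OF K_prob_algebra])

lemma
  assumes "y > 0"
  shows prob_space_K: "prob_space (K y)" and sets_K: "sets (K y) = sets pos_borel"
  using measurable_space[OF K_prob_algebra, of y] assms by (auto simp: space_prob_algebra)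

lemma space_K: "y > 0 \<Longrightarrow> space (K y) = {0<..}"
  using sets_eq_imp_space_eq[OF sets_K] by simp

lemma nn_integral_K: "y > 0 \<Longrightarrow> (\<integral>\<^sup>+z. ennreal z \<partial>K y) = ennreal y"
  using kernel by (simp add: martingale_kernel_def)

lemma S_measurable_pos [measurable]: "S k \<in> P \<rightarrow>\<^sub>M pos_borel"
  using chain by (simp add: markov_chain_from_def)

lemma S_measurable [measurable]: "S k \<in> borel_measurable P"
  by (rule measurable_pos_borel_imp_borel) simp

lemma S_pos: "\<omega> \<in> space P \<Longrightarrow> S k \<omega> > 0"
  using measurable_space[OF S_measurable_pos, of \<omega> k] by simp

lemma S_0: "AE \<omega> in P. S 0 \<omega> = x"
  using chain by (simp add: markov_chain_from_def)

lemma sets_F_subset: "sets (F n) \<subseteq> sets P"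
  unfolding sets_natural_filtration
  by (intro sets.sigma_sets_subset) (auto intro: measurable_sets[OF S_measurable_pos])

lemma sets_F_D: "A \<in> sets (F n) \<Longrightarrow> A \<in> sets P"
  using sets_F_subset by auto

lemma S_measurable_F_pos: "k \<le> n \<Longrightarrow> S k \<in> F n \<rightarrow>\<^sub>M pos_borel"
  by (rule measurableI) (auto simp: S_pos sets_natural_filtration intro!: sigma_sets.Basic)

lemma S_measurable_F: "k \<le> n \<Longrightarrow> S k \<in> borel_measurable (F n)"
  by (rule measurable_pos_borel_imp_borel) (rule S_measurable_F_pos)

text \<open>Integrating the conditional probability from \<open>markov_chain_from\<close> over
  \<open>B\<close> yields the identity for real integrals. The integrand is bounded by 1, so it
  transfers to \<open>ennreal\<close>.\<close>

lemma emeasure_Suc: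
  assumes B: "B \<in> sets (F n)" and A: "A \<in> sets pos_borel"
  shows "emeasure P (B \<inter> (S (Suc n) -` A \<inter> space P)) =
    (\<integral>\<^sup>+\<omega>. indicator B \<omega> * emeasure (K (S n \<omega>)) A \<partial>P)"
proof -
  let ?D = "S (Suc n) -` A \<inter> space P"
  have sub: "subalgebra P (F n)"
    using sets_F_subset by (simp add: subalgebra_def)
  interpret sub: sigma_finite_subalgebra P "F n"
    by (intro finite_measure_subalgebra_is_sigma_finite finite_measure_subalgebra.intro
        finite_measure_subalgebra_axioms.intro finite_measure_axioms sub)
  have [measurable]: "?D \<in> sets P" by (rule measurable_sets[OF S_measurable_pos A])
  have [measurable]: "B \<in> sets P" by (rule sets_F_D[OF B])
  have Km: "(\<lambda>y. measure (K y) A) \<in> borel_measurable pos_borel"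
    using A by measurable
  have [measurable]: "(\<lambda>\<omega>. measure (K (S n \<omega>)) A) \<in> borel_measurable P"
    by (rule measurable_compose[OF S_measurable_pos Km])
  have le1: "measure (K (S n \<omega>)) A \<le> 1" if "\<omega> \<in> space P" for \<omega>
    by (rule prob_space.prob_le_1[OF prob_space_K[OF S_pos[OF that]]])
  have int: "integrable P (\<lambda>\<omega>. indicator B \<omega> * measure (K (S n \<omega>)) A)"
    by (rule integrable_const_bound[of _ 1]) (auto simp: le1 split: split_indicator)
  have cond: "AE \<omega> in P. real_cond_exp P (F n) (indicator ?D) \<omega> = measure (K (S n \<omega>)) A"
    using chain A by (simp add: markov_chain_from_def)
  have "measure P (B \<inter> ?D) = (\<integral>\<omega>\<in>B. indicator ?D \<omega> \<partial>P)"
    by (simp add: set_lebesgue_integral_def indicator_inter_arith[symmetric])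
  also have "\<dots> = (\<integral>\<omega>\<in>B. real_cond_exp P (F n) (indicator ?D) \<omega> \<partial>P)"
    by (rule sub.real_cond_exp_intA[OF _ B]) (simp add: less_top[symmetric])
  also have "\<dots> = (\<integral>\<omega>. indicator B \<omega> * measure (K (S n \<omega>)) A \<partial>P)"
    unfolding set_lebesgue_integral_def
    by (rule integral_cong_AE) (use cond in \<open>auto\<close>)
  finally have "emeasure P (B \<inter> ?D) = ennreal (\<integral>\<omega>. indicator B \<omega> * measure (K (S n \<omega>)) A \<partial>P)"
    by (simp add: emeasure_eq_measure)
  also have "\<dots> = (\<integral>\<^sup>+\<omega>. ennreal (indicator B \<omega> * measure (K (S n \<omega>)) A) \<partial>P)"
    by (rule nn_integral_eq_integral[symmetric, OF int]) auto
  also have "\<dots> = (\<integral>\<^sup>+\<omega>. indicator B \<omega> * emeasure (K (S n \<omega>)) A \<partial>P)"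
    by (intro nn_integral_cong)
       (auto split: split_indicator
         simp: finite_measure.emeasure_eq_measure prob_space.finite_measure prob_space_K S_pos)
  finally show ?thesis .
qed

text \<open>Both sides integrate \<open>f\<close> against finite measures on pairs: the law of two
  successive states restricted to \<open>B\<close>, and the mixture of the kernels over
  \<open>B\<close>. By \<open>emeasure_Suc\<close> the two agree on rectangles, an
  intersection-stable generator, hence everywhere. Letting \<open>f\<close> see both states covers
  events such as a step that does not go down.\<close>

lemma nn_integral_Suc:
  assumes B: "B \<in> sets (F n)"
    and f [measurable]: "f \<in> borel_measurable (pos_borel \<Otimes>\<^sub>M pos_borel)"
  shows "(\<integral>\<^sup>+\<omega>. indicator B \<omega> * f (S n \<omega>, S (Suc n) \<omega>) \<partial>P) =
    (\<integral>\<^sup>+\<omega>. indicator B \<omega> * (\<integral>\<^sup>+y. f (S n \<omega>, y) \<partial>K (S n \<omega>)) \<partial>P)"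
proof -
  let ?E = "pos_borel :: real measure" and ?EE = "pos_borel \<Otimes>\<^sub>M pos_borel :: (real \<times> real) measure"
  let ?D = "density P (indicator B)"
  let ?N = "\<lambda>\<omega>. distr (K (S n \<omega>)) ?EE (Pair (S n \<omega>))"
  let ?\<mu> = "distr ?D ?EE (\<lambda>\<omega>. (S n \<omega>, S (Suc n) \<omega>))" and ?\<nu> = "?D \<bind> ?N"
  have [measurable]: "B \<in> sets P" by (rule sets_F_D[OF B])
  have Em: "(\<lambda>y. distr (K y) ?EE (Pair y)) \<in> ?E \<rightarrow>\<^sub>M subprob_algebra ?EE"
    by (rule measurable_distr2[where M="?E"]) simp_all
  have N: "?N \<in> P \<rightarrow>\<^sub>M subprob_algebra ?EE"
    by (rule measurable_compose[OF S_measurable_pos Em])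
  then have N': "?N \<in> ?D \<rightarrow>\<^sub>M subprob_algebra ?EE" by simp
  have ne: "space ?D \<noteq> {}" using not_empty by simp
  have Pair_m: "Pair y \<in> K y \<rightarrow>\<^sub>M ?EE" if "y > 0" for y
    using that by (subst measurable_cong_sets[OF sets_K refl]) simp_all
  have inner: "(\<integral>\<^sup>+z. g z \<partial>?N \<omega>) = (\<integral>\<^sup>+y. g (S n \<omega>, y) \<partial>K (S n \<omega>))"
    if "\<omega> \<in> space P" and "g \<in> borel_measurable ?EE" for \<omega> and g :: "_ \<Rightarrow> ennreal"
    using Pair_m[OF S_pos[OF that(1)]] that(2) by (simp add: nn_integral_distr)
  have g_m: "(\<lambda>\<omega>. \<integral>\<^sup>+z. g z \<partial>?N \<omega>) \<in> borel_measurable P"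
    if "g \<in> borel_measurable ?EE" for g :: "_ \<Rightarrow> ennreal"
    by (rule measurable_compose[OF N nn_integral_measurable_subprob_algebra[OF that]])
  have nu: "(\<integral>\<^sup>+z. g z \<partial>?\<nu>) = (\<integral>\<^sup>+\<omega>. indicator B \<omega> * (\<integral>\<^sup>+y. g (S n \<omega>, y) \<partial>K (S n \<omega>)) \<partial>P)"
    if g: "g \<in> borel_measurable ?EE" for g :: "_ \<Rightarrow> ennreal"
    by (subst nn_integral_bind[OF g N'], subst nn_integral_density)
       (auto intro!: nn_integral_cong g_m g simp: inner g)
  have "?\<mu> = ?\<nu>"
  proof (rule measure_eqI_generator_eq)
    let ?G = "{a \<times> b | a b. a \<in> sets ?E \<and> b \<in> sets ?E}"
    show "Int_stable ?G" by (rule Int_stable_pair_measure_generator)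
    show "?G \<subseteq> Pow (space ?E \<times> space ?E)" by (rule pair_measure_closed)
    show "sets ?\<mu> = sigma_sets (space ?E \<times> space ?E) ?G"
      by (simp add: sets_pair_measure)
    show "sets ?\<nu> = sigma_sets (space ?E \<times> space ?E) ?G"
      by (subst sets_bind_measurable[OF N' ne]) (rule sets_pair_measure)
    show "range (\<lambda>_::nat. space ?E \<times> space ?E) \<subseteq> ?G" by blast
    show "(\<Union>i::nat. space ?E \<times> space ?E) = space ?E \<times> space ?E" by simp
    show "emeasure ?\<mu> (space ?E \<times> space ?E) \<noteq> \<infinity>"
    proof -
      have "emeasure ?\<mu> (space ?E \<times> space ?E) \<le> emeasure P B"
        by (subst emeasure_distr)
           (auto simp: emeasure_restricted intro!: emeasure_mono simp del: space_pos_borel)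
      then show ?thesis using emeasure_finite[of B] by (auto simp: top_unique)
    qed
  next
    fix X assume "X \<in> {a \<times> b | a b. a \<in> sets ?E \<and> b \<in> sets ?E}"
    then obtain a b where X: "X = a \<times> b" and [measurable]: "a \<in> sets ?E" "b \<in> sets ?E" by auto
    have X_m [measurable]: "X \<in> sets ?EE" unfolding X by simp
    \<comment> \<open>The condition on the first coordinate is observable at time \<open>n\<close>
      and is absorbed into the event, so only the second coordinate is left for
      \<open>emeasure_Suc\<close>.\<close>
    let ?B = "B \<inter> (S n -` a \<inter> space P)"
    have B': "?B \<in> sets (F n)"
      using B measurable_sets[OF S_measurable_F_pos[OF le_refl], of a n] by auto
    have "emeasure ?\<mu> X = emeasure P (?B \<inter> (S (Suc n) -` b \<inter> space P))"
      by (subst emeasure_distr)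
         (auto simp: emeasure_restricted X intro!: arg_cong[where f="emeasure P"])
    also have "\<dots> = (\<integral>\<^sup>+\<omega>. indicator ?B \<omega> * emeasure (K (S n \<omega>)) b \<partial>P)"
      by (rule emeasure_Suc[OF B']) simp
    also have "\<dots> = (\<integral>\<^sup>+\<omega>. indicator B \<omega> * (\<integral>\<^sup>+y. indicator X (S n \<omega>, y) \<partial>K (S n \<omega>)) \<partial>P)"
      by (intro nn_integral_cong) (auto simp: X indicator_times sets_K S_pos split: split_indicator)
    also have "\<dots> = emeasure ?\<nu> X"
      by (subst nu[symmetric]) (auto simp: sets_bind_measurable[OF N' ne])
    finally show "emeasure ?\<mu> X = emeasure ?\<nu> X" .
  qed
  have "(\<integral>\<^sup>+\<omega>. indicator B \<omega> * f (S n \<omega>, S (Suc n) \<omega>) \<partial>P) = (\<integral>\<^sup>+z. f z \<partial>?\<mu>)"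
    by (subst nn_integral_distr) (simp_all add: nn_integral_density)
  also have "\<dots> = (\<integral>\<^sup>+\<omega>. indicator B \<omega> * (\<integral>\<^sup>+y. f (S n \<omega>, y) \<partial>K (S n \<omega>)) \<partial>P)"
    unfolding \<open>?\<mu> = ?\<nu>\<close> by (rule nu) simp
  finally show ?thesis .
qed

end


section \<open>Counting downticks\<close>

definition downtick_count :: "(nat \<Rightarrow> 'w \<Rightarrow> real) \<Rightarrow> nat \<Rightarrow> 'w \<Rightarrow> nat" where
  "downtick_count S m \<omega> = (\<Sum>i<m. of_bool (S (Suc i) \<omega> < S i \<omega>))"

lemma downtick_count_0 [simp]: "downtick_count S 0 \<omega> = 0"
  by (simp add: downtick_count_def)

lemma downtick_count_Suc [simp]:
  "downtick_count S (Suc m) \<omega> = downtick_count S m \<omega> + of_bool (S (Suc m) \<omega> < S m \<omega>)"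
  by (simp add: downtick_count_def)

lemma downtick_count_mono: "m \<le> n \<Longrightarrow> downtick_count S m \<omega> \<le> downtick_count S n \<omega>"
  by (induction rule: dec_induct) auto

text \<open>Stated in the shape of the recursion for \<open>downtick\<close>, so that the induction
  step of \<open>downtick_le_iff\<close> compares two existential statements.\<close>

lemma Suc_le_downtick_count_iff:
  "Suc k \<le> downtick_count S m \<omega> \<longleftrightarrow>
     (\<exists>i<m. k \<le> downtick_count S i \<omega> \<and> S (Suc i) \<omega> < S i \<omega>)"
  by (induction m) (auto simp: less_Suc_eq of_bool_def)

text \<open>Translates the \<open>enat\<close>-valued times into counts, which are adapted and suit
  induction over time. The infimum of a nonempty set in \<open>enat\<close> is attained, so a bound
  on it amounts to the existence of a suitable downtick up to \<open>m\<close>.\<close>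

lemma downtick_le_iff: "downtick S k \<omega> \<le> enat m \<longleftrightarrow> k \<le> downtick_count S m \<omega>"
proof (induction k arbitrary: m)
  case 0
  show ?case by (simp add: zero_enat_def)
next
  case (Suc k)
  let ?A = "{enat j | j. downtick S k \<omega> < enat j \<and> S j \<omega> < S (j - 1) \<omega>}"
  have "downtick S (Suc k) \<omega> \<le> enat m \<longleftrightarrow> (\<exists>a\<in>?A. a \<le> enat m)"
  proof
    assume le: "downtick S (Suc k) \<omega> \<le> enat m"
    then have "?A \<noteq> {}" by (intro notI) (simp only: downtick.simps Inf_enat_def, simp)
    then have "Inf ?A \<in> ?A" by (auto simp: Inf_enat_def intro: LeastI)
    with le show "\<exists>a\<in>?A. a \<le> enat m" by auto
  next
    assume "\<exists>a\<in>?A. a \<le> enat m"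
    then show "downtick S (Suc k) \<omega> \<le> enat m" by (auto intro: Inf_lower2)
  qed
  also have "\<dots> \<longleftrightarrow> (\<exists>j\<le>m. downtick S k \<omega> < enat j \<and> S j \<omega> < S (j - 1) \<omega>)"
    by auto
  \<comment> \<open>Substitute \<open>j = Suc i\<close>; the case \<open>j = 0\<close> cannot occur
    because nothing lies below \<open>enat 0\<close>.\<close>
  also have "\<dots> \<longleftrightarrow> (\<exists>i<m. downtick S k \<omega> < enat (Suc i) \<and> S (Suc i) \<omega> < S i \<omega>)"
  proof (intro iffI; elim exE conjE)
    fix j assume "j \<le> m" "downtick S k \<omega> < enat j" "S j \<omega> < S (j - 1) \<omega>"
    then show "\<exists>i<m. downtick S k \<omega> < enat (Suc i) \<and> S (Suc i) \<omega> < S i \<omega>"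
      by (intro exI[of _ "j - 1"]) (cases j; auto)
  next
    fix i assume "i < m" "downtick S k \<omega> < enat (Suc i)" "S (Suc i) \<omega> < S i \<omega>"
    then show "\<exists>j\<le>m. downtick S k \<omega> < enat j \<and> S j \<omega> < S (j - 1) \<omega>"
      by (intro exI[of _ "Suc i"]) auto
  qed
  also have "\<dots> \<longleftrightarrow> (\<exists>i<m. downtick S k \<omega> \<le> enat i \<and> S (Suc i) \<omega> < S i \<omega>)"
    by (metis Suc_ile_eq not_less)
  also have "\<dots> \<longleftrightarrow> Suc k \<le> downtick_count S m \<omega>"
    unfolding Suc.IH Suc_le_downtick_count_iff ..
  finally show ?case .
qed

lemma stopped_value_downtick:
  assumes "downtick_count S m \<omega> < k" and "k \<le> downtick_count S (Suc m) \<omega>"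
  shows "stopped_value S (downtick S k) \<omega> = S (Suc m) \<omega>"
proof -
  have "enat m < downtick S k \<omega>" "downtick S k \<omega> \<le> enat (Suc m)"
    using assms downtick_le_iff[of S k \<omega>] by (simp_all add: not_le[symmetric])
  then have "downtick S k \<omega> = enat (Suc m)"
    by (simp add: Suc_ile_eq[symmetric])
  then show ?thesis by (simp add: stopped_value_def)
qed

section \<open>Nondecreasing stretches and the martingale property\<close>

context markov_martingale
begin

definition up :: "nat \<Rightarrow> nat \<Rightarrow> 'w set" where
  "up n m = {\<omega>\<in>space P. \<forall>i\<in>{n..<m}. S i \<omega> \<le> S (Suc i) \<omega>}"

lemma pred_F_tick:
  "i < m \<Longrightarrow> Measurable.pred (F m) (\<lambda>\<omega>. S (Suc i) \<omega> < S i \<omega>)"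
  using S_measurable_F[of i m] S_measurable_F[of "Suc i" m] by simp

lemma up_in_F: "up n m \<in> sets (F m)"
proof -
  have "Measurable.pred (F m) (\<lambda>\<omega>. \<forall>i\<in>{n..<m}. \<not> S (Suc i) \<omega> < S i \<omega>)"
    using pred_F_tick[of _ m] by (intro pred_intros_finite pred_intros_logic) auto
  then show ?thesis by (simp add: pred_def up_def not_less)
qed

lemma up_in_sets [measurable]: "up n m \<in> sets P"
  by (rule sets_F_D[OF up_in_F])

lemma up_Suc: "n \<le> m \<Longrightarrow> up n (Suc m) = up n m \<inter> {\<omega>. S m \<omega> \<le> S (Suc m) \<omega>}"
  by (auto simp: up_def less_Suc_eq)

lemma downtick_count_measurable_F: "downtick_count S m \<in> F m \<rightarrow>\<^sub>M count_space UNIV"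
proof -
  have "(\<lambda>\<omega>. downtick_count S j \<omega>) \<in> F m \<rightarrow>\<^sub>M count_space UNIV" if "j \<le> m" for j
    using that
  proof (induction j)
    case 0
    show ?case by simp
  next
    case (Suc j)
    then have [measurable]: "downtick_count S j \<in> F m \<rightarrow>\<^sub>M count_space UNIV"
      "Measurable.pred (F m) (\<lambda>\<omega>. S (Suc j) \<omega> < S j \<omega>)"
      using pred_F_tick[of j m] by auto
    show ?case unfolding downtick_count_Suc of_bool_def by measurable
  qed
  then show ?thesis by simp
qed

lemma downtick_count_in_F: "{\<omega>\<in>space P. Q (downtick_count S m \<omega>)} \<in> sets (F m)"
  using measurable_sets[OF downtick_count_measurable_F, of "{j. Q j}" m]
  by (simp add: vimage_def Int_def conj_commute)

lemma downtick_count_up: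
  assumes "\<omega> \<in> up n m" "n \<le> m"
  shows "downtick_count S m \<omega> = downtick_count S n \<omega>"
  using assms(2,1) by (induction rule: dec_induct) (auto simp: up_Suc of_bool_def)

text \<open>At each step \<open>sub\<close> keeps only the moves that do not go down, and the Markov
  property replaces the integration variable by \<open>S (Suc m)\<close>. The factor
  \<open>indicator {y..}\<close> then becomes the extra condition in
  \<open>up n (Suc m)\<close>.\<close>

lemma nn_integral_le_up:
  assumes g [measurable]: "g \<in> borel_measurable pos_borel"
    and sub: "\<And>y. y > 0 \<Longrightarrow> g y \<le> (\<integral>\<^sup>+z. indicator {y..} z * g z \<partial>K y)"
    and B: "B \<in> sets (F n)" and "n \<le> m"
  shows "(\<integral>\<^sup>+\<omega>. indicator B \<omega> * g (S n \<omega>) \<partial>P) \<le>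
    (\<integral>\<^sup>+\<omega>. indicator (B \<inter> up n m) \<omega> * g (S m \<omega>) \<partial>P)"
  using \<open>n \<le> m\<close>
proof (induction rule: dec_induct)
  case base
  have "B \<inter> up n n = B" using sets.sets_into_space[OF sets_F_D[OF B]] by (auto simp: up_def)
  then show ?case by simp
next
  case (step m)
  have Bm: "B \<inter> up n m \<in> sets (F m)"
    using B sets_natural_filtration_mono[OF step(1), of P S] up_in_F[of n m] by auto
  let ?f = "\<lambda>(y, z). indicator {y..} z * g z"
  have "?f = (\<lambda>p. indicator {p. fst p \<le> snd p} p * g (snd p))"
    by (auto split: split_indicator)
  moreover have "\<dots> \<in> borel_measurable (pos_borel \<Otimes>\<^sub>M pos_borel)"
    by measurable
  ultimately have f: "?f \<in> borel_measurable (pos_borel \<Otimes>\<^sub>M pos_borel)" by simp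
  have "(\<integral>\<^sup>+\<omega>. indicator (B \<inter> up n m) \<omega> * g (S m \<omega>) \<partial>P) \<le>
      (\<integral>\<^sup>+\<omega>. indicator (B \<inter> up n m) \<omega> * (\<integral>\<^sup>+z. ?f (S m \<omega>, z) \<partial>K (S m \<omega>)) \<partial>P)"
    by (intro nn_integral_mono mult_left_mono) (auto intro!: sub S_pos)
  also have "\<dots> = (\<integral>\<^sup>+\<omega>. indicator (B \<inter> up n m) \<omega> * ?f (S m \<omega>, S (Suc m) \<omega>) \<partial>P)"
    by (rule nn_integral_Suc[OF Bm f, symmetric])
  also have "\<dots> = (\<integral>\<^sup>+\<omega>. indicator (B \<inter> up n (Suc m)) \<omega> * g (S (Suc m) \<omega>) \<partial>P)"
    using step(1) by (intro nn_integral_cong) (auto simp: up_Suc split: split_indicator)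
  finally show ?case using step.IH by simp
qed

text \<open>The martingale property on events of \<open>F n\<close>: apply the Markov property to
  the second coordinate and use that \<open>K y\<close> has mean \<open>y\<close>.\<close>

lemma nn_integral_S_Suc:
  assumes B: "B \<in> sets (F n)"
  shows "(\<integral>\<^sup>+\<omega>. indicator B \<omega> * ennreal (S (Suc n) \<omega>) \<partial>P) =
    (\<integral>\<^sup>+\<omega>. indicator B \<omega> * ennreal (S n \<omega>) \<partial>P)"
proof -
  have "(\<lambda>p. ennreal (snd p)) \<in> borel_measurable (pos_borel \<Otimes>\<^sub>M pos_borel)" by measurable
  from nn_integral_Suc[OF B this] show ?thesis
    by (simp add: S_pos nn_integral_K cong: nn_integral_cong)
qed

lemma nn_integral_S: "(\<integral>\<^sup>+\<omega>. ennreal (S n \<omega>) \<partial>P) = ennreal x"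
proof (induction n)
  case 0
  have "(\<integral>\<^sup>+\<omega>. ennreal (S 0 \<omega>) \<partial>P) = (\<integral>\<^sup>+\<omega>. ennreal x \<partial>P)"
    using S_0 by (intro nn_integral_cong_AE) auto
  then show ?case by (simp add: emeasure_space_1)
next
  case (Suc n)
  have "(\<integral>\<^sup>+\<omega>. ennreal (S (Suc n) \<omega>) \<partial>P) = (\<integral>\<^sup>+\<omega>. indicator (space P) \<omega> * ennreal (S (Suc n) \<omega>) \<partial>P)"
    by (intro nn_integral_cong) simp
  also have "\<dots> = (\<integral>\<^sup>+\<omega>. indicator (space P) \<omega> * ennreal (S n \<omega>) \<partial>P)"
    using sets.top[of "F n"] by (intro nn_integral_S_Suc) simp
  also have "\<dots> = (\<integral>\<^sup>+\<omega>. ennreal (S n \<omega>) \<partial>P)"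
    by (intro nn_integral_cong) simp
  finally show ?case using Suc by simp
qed

lemma integrable_S: "integrable P (S n)"
  using nn_integral_S[of n] by (intro integrableI_nonneg) (auto intro: AE_I2 less_imp_le[OF S_pos])

lemma nn_integral_liminf_S: "(\<integral>\<^sup>+\<omega>. liminf (\<lambda>n. ennreal (S n \<omega>)) \<partial>P) \<le> ennreal x"
  using nn_integral_liminf[of "\<lambda>n \<omega>. ennreal (S n \<omega>)" P] by (simp add: nn_integral_S Liminf_const)

text \<open>Serves to exclude paths that increase to infinity in \<open>AE_downtick\<close>.\<close>

lemma AE_liminf_S_finite: "AE \<omega> in P. liminf (\<lambda>n. ennreal (S n \<omega>)) \<noteq> \<infinity>"
  by (rule nn_integral_noteq_infinite) (use nn_integral_liminf_S in \<open>auto simp: top_unique\<close>)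

text \<open>Off the set of convergence \<open>S_lim\<close> is the constant \<open>THE l. False\<close>, so Fatou's lemma suffices
  and the martingale convergence theorem is not needed.\<close>
lemma integrable_S_lim: "integrable P (S_lim S)"
proof (rule integrableI_bounded)
  let ?c = "THE l::real. False"
  show m: "S_lim S \<in> borel_measurable P"
    unfolding S_lim_def[abs_def] by measurable
  have le: "ennreal (norm (S_lim S \<omega>)) \<le> ennreal \<bar>?c\<bar> + liminf (\<lambda>n. ennreal (S n \<omega>))"
    if w: "\<omega> \<in> space P" for \<omega>
  proof (cases "convergent (\<lambda>n. S n \<omega>)")
    case True
    then have lim: "(\<lambda>n. S n \<omega>) \<longlonglongrightarrow> S_lim S \<omega>"
      by (simp add: S_lim_def convergent_LIMSEQ_iff)
    have "0 \<le> S_lim S \<omega>"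
      by (rule LIMSEQ_le_const[OF lim]) (auto intro: less_imp_le[OF S_pos[OF w]])
    moreover have "liminf (\<lambda>n. ennreal (S n \<omega>)) = ennreal (S_lim S \<omega>)"
      using lim by (intro lim_imp_Liminf tendsto_ennrealI) auto
    ultimately show ?thesis by simp
  next
    case False
    then have "S_lim S \<omega> = ?c"
      by (auto simp: S_lim_def lim_def convergent_def)
    then show ?thesis by simp
  qed
  have "(\<integral>\<^sup>+\<omega>. ennreal (norm (S_lim S \<omega>)) \<partial>P) \<le>
      (\<integral>\<^sup>+\<omega>. ennreal \<bar>?c\<bar> + liminf (\<lambda>n. ennreal (S n \<omega>)) \<partial>P)"
    by (intro nn_integral_mono le)
  also have "\<dots> \<le> ennreal \<bar>?c\<bar> + ennreal x"
    using nn_integral_liminf_S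
    by (subst nn_integral_add) (auto simp: emeasure_space_1 intro: add_left_mono)
  also have "\<dots> < \<infinity>" by (simp add: less_top[symmetric])
  finally show "(\<integral>\<^sup>+\<omega>. ennreal (norm (S_lim S \<omega>)) \<partial>P) < \<infinity>" .
qed

end

section \<open>Almost surely infinitely many downticks\<close>

locale downtick_martingale = markov_martingale +
  assumes down_prob: "\<And>a b. 0 < a \<Longrightarrow> a < b \<Longrightarrow> (INF y\<in>{a..b}. measure (K y) {0<..<y}) > 0"
begin

text \<open>From any state of the interval a step avoids a downtick with probability at most
  \<open>1 - e\<close>, where \<open>e\<close> bounds the downward probabilities from below.
  Surviving \<open>j\<close> such steps has probability at most \<open>(1 - e) ^ j\<close>, which
  tends to 0.\<close>

lemma AE_leaves_interval:
  assumes a: "0 < a" and ab: "a < b"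
  shows "AE \<omega> in P. \<exists>i\<ge>n. \<not> (a \<le> S i \<omega> \<and> S i \<omega> \<le> b \<and> S i \<omega> \<le> S (Suc i) \<omega>)"
proof -
  define e where "e = (INF y\<in>{a..b}. measure (K y) {0<..<y})"
  have e: "e > 0" unfolding e_def by (rule down_prob[OF a ab])
  have e_le: "e \<le> measure (K y) {0<..<y}" if "a \<le> y" "y \<le> b" for y
    unfolding e_def using that by (intro cINF_lower) (auto intro!: bdd_belowI[of _ 0])
  have up_K: "(\<integral>\<^sup>+z. indicator {p. fst p \<le> snd p} (y, z) \<partial>K y) \<le> ennreal (1 - e)"
    if "a \<le> y" "y \<le> b" for y
  proof -
    have y: "y > 0" using that a by simp
    interpret Ky: prob_space "K y" by (rule prob_space_K[OF y])
    have s: "{0<..<y} \<in> sets (K y)"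
      by (simp add: sets_K[OF y]) (auto simp: pos_borel_def sets_restrict_space_iff)
    have "(\<integral>\<^sup>+z. indicator {p. fst p \<le> snd p} (y, z) \<partial>K y) =
        (\<integral>\<^sup>+z. indicator (space (K y) - {0<..<y}) z \<partial>K y)"
      using y by (intro nn_integral_cong) (auto simp: space_K split: split_indicator)
    also have "\<dots> = emeasure (K y) (space (K y) - {0<..<y})"
      using s by (intro nn_integral_indicator) auto
    also have "\<dots> = ennreal (1 - measure (K y) {0<..<y})"
      using Ky.prob_compl[OF s] by (simp add: Ky.emeasure_eq_measure)
    also have "\<dots> \<le> ennreal (1 - e)"
      using e_le[OF that] by (intro ennreal_leI) simp
    finally show ?thesis .
  qed
  \<comment> \<open>The endpoint \<open>S (n + j)\<close> is also required to lie in the interval,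
    so that \<open>up_K\<close> bounds the next step.\<close>
  define G where "G j = {\<omega>\<in>space P. \<forall>i\<in>{n..n+j}. a \<le> S i \<omega> \<and> S i \<omega> \<le> b} \<inter> up n (n + j)" for j
  have G_F: "G j \<in> sets (F (n + j))" for j
  proof -
    have "Measurable.pred (F (n + j)) (\<lambda>\<omega>. \<forall>i\<in>{n..n+j}. a \<le> S i \<omega> \<and> S i \<omega> \<le> b)"
      using S_measurable_F[of _ "n + j"] by (intro pred_intros_finite pred_intros_logic) auto
    then show ?thesis using up_in_F[of n "n + j"] by (auto simp: G_def pred_def)
  qed
  have G_le: "emeasure P (G j) \<le> ennreal (1 - e) ^ j" for j
  proof (induction j)
    case 0
    show ?case by (simp add: measure_le_1 emeasure_eq_measure)
  next
    case (Suc j)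
    have m: "(\<lambda>p. indicator {p. fst p \<le> snd p} p :: ennreal) \<in> borel_measurable (pos_borel \<Otimes>\<^sub>M pos_borel)"
      by measurable
    have "emeasure P (G (Suc j)) = (\<integral>\<^sup>+\<omega>. indicator (G (Suc j)) \<omega> \<partial>P)"
      using sets_F_D[OF G_F[of "Suc j"]] by simp
    also have "\<dots> \<le> (\<integral>\<^sup>+\<omega>. indicator (G j) \<omega> *
        indicator {p. fst p \<le> snd p} (S (n + j) \<omega>, S (Suc (n + j)) \<omega>) \<partial>P)"
      by (intro nn_integral_mono) (auto simp: G_def up_Suc split: split_indicator)
    also have "\<dots> = (\<integral>\<^sup>+\<omega>. indicator (G j) \<omega> *
        (\<integral>\<^sup>+z. indicator {p. fst p \<le> snd p} (S (n + j) \<omega>, z) \<partial>K (S (n + j) \<omega>)) \<partial>P)"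
      by (rule nn_integral_Suc[OF G_F m])
    also have "\<dots> \<le> (\<integral>\<^sup>+\<omega>. indicator (G j) \<omega> * ennreal (1 - e) \<partial>P)"
      using up_K by (intro nn_integral_mono) (auto simp: G_def split: split_indicator)
    also have "\<dots> = emeasure P (G j) * ennreal (1 - e)"
      using sets_F_D[OF G_F[of j]] by (simp add: nn_integral_multc)
    also have "\<dots> \<le> ennreal (1 - e) ^ Suc j"
      using Suc by (simp add: mult.commute mult_left_mono)
    finally show ?case .
  qed
  let ?H = "{\<omega>\<in>space P. \<not> (\<exists>i\<ge>n. \<not> (a \<le> S i \<omega> \<and> S i \<omega> \<le> b \<and> S i \<omega> \<le> S (Suc i) \<omega>))}"
  have H: "?H \<in> sets P" by measurable
  \<comment> \<open>Nonnegativity of \<open>1 - e\<close> lets \<open>ennreal\<close> commute with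
    the power and gives convergence to 0.\<close>
  have e1: "e \<le> 1"
    using e_le[of a] ab prob_space.prob_le_1[OF prob_space_K[OF a], of "{0<..<a}"] by simp
  have "(\<lambda>j. ennreal ((1 - e) ^ j)) \<longlonglongrightarrow> ennreal 0"
    using e e1 by (intro tendsto_ennrealI LIMSEQ_power_zero) auto
  moreover have "emeasure P ?H \<le> ennreal ((1 - e) ^ j)" for j
  proof -
    have "emeasure P ?H \<le> emeasure P (G j)"
      using sets_F_D[OF G_F[of j]] by (intro emeasure_mono) (auto simp: G_def up_def)
    also have "\<dots> \<le> ennreal ((1 - e) ^ j)" using G_le e1 by (simp add: ennreal_power)
    finally show ?thesis .
  qed
  ultimately have "emeasure P ?H \<le> ennreal 0"
    by (intro LIMSEQ_le_const) auto
  then show ?thesis using H by (intro AE_I[OF _ _ H]) auto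
qed

text \<open>Without a downtick after \<open>n\<close> the path is nondecreasing from there on, hence
  bounded below by \<open>S n \<omega> > 0\<close> and, its liminf being finite, bounded above. It
  would then stay in one of countably many intervals exhausting the half-line, each of which
  \<open>AE_leaves_interval\<close> excludes almost surely.\<close>

lemma AE_downtick: "AE \<omega> in P. \<exists>i\<ge>n. S (Suc i) \<omega> < S i \<omega>"
proof -
  \<comment> \<open>The upper end is \<open>r + 2\<close> because \<open>r + 1\<close> would give a
    degenerate interval at \<open>r = 0\<close>.\<close>
  have "AE \<omega> in P. \<forall>r::nat. \<exists>i\<ge>n.
      \<not> (1 / (real r + 1) \<le> S i \<omega> \<and> S i \<omega> \<le> real r + 2 \<and> S i \<omega> \<le> S (Suc i) \<omega>)"
    unfolding AE_all_countable
  proof (intro allI AE_leaves_interval)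
    fix r :: nat
    have "1 / (real r + 1) \<le> 1" by simp
    then show "1 / (real r + 1) < real r + 2" by linarith
  qed simp
  then show ?thesis using AE_liminf_S_finite AE_space
  proof eventually_elim
    case (elim \<omega>)
    show ?case
    proof (rule ccontr)
      assume "\<not> ?case"
      then have up: "S i \<omega> \<le> S (Suc i) \<omega>" if "i \<ge> n" for i using that by (auto simp: not_less)
      have mono: "S i \<omega> \<le> S j \<omega>" if "n \<le> i" "i \<le> j" for i j
        using that(2) by (induction rule: dec_induct) (use up that(1) in \<open>auto intro: order_trans\<close>)
      let ?L = "liminf (\<lambda>n. ennreal (S n \<omega>))"
      \<comment> \<open>One more than the liminf: a monotone path that once exceeded
        \<open>b\<close> would have liminf at least \<open>b\<close>.\<close>
      define b where "b = enn2real ?L + 1"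
      have b: "b > 0" by (simp add: b_def add_nonneg_pos)
      have bound: "S i \<omega> \<le> b" if "i \<ge> n" for i
      proof (rule ccontr)
        assume "\<not> S i \<omega> \<le> b"
        then have "eventually (\<lambda>j. ennreal b \<le> ennreal (S j \<omega>)) sequentially"
          using mono[OF that] unfolding eventually_sequentially
          by (intro exI[of _ i]) (force intro!: ennreal_leI)
        then have "ennreal b \<le> ?L" by (rule Liminf_bounded)
        then have "b \<le> enn2real ?L"
          using elim(2) b by (cases ?L) (auto simp: ennreal_le_iff2)
        then show False by (simp add: b_def)
      qed
      have pos: "S n \<omega> > 0" using S_pos elim(3) .
      obtain r :: nat where r: "real r \<ge> max b (1 / S n \<omega>)" using real_arch_simple by blast
      have "1 / (real r + 1) \<le> S n \<omega>"
      proof -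
        have "1 \<le> real r * S n \<omega>" using r pos by (simp add: field_simps)
        also have "\<dots> \<le> (real r + 1) * S n \<omega>" using pos by (simp add: mult_right_mono)
        finally show ?thesis by (simp add: field_simps)
      qed
      then have "\<forall>i\<ge>n. 1 / (real r + 1) \<le> S i \<omega>" using mono[of n] by (auto intro: order_trans)
      moreover have "\<forall>i\<ge>n. S i \<omega> \<le> real r + 2" using bound r by force
      ultimately show False using elim(1) up by blast
    qed
  qed
qed

end

section \<open>Optional stopping at the downtick times\<close>

context markov_martingale
begin

text \<open>Optional stopping at the minimum of the \<open>k\<close>-th downtick time and
  \<open>m\<close>. The paths not stopped by time \<open>m\<close> form an event of
  \<open>F m\<close>; at time \<open>Suc m\<close> it splits into those stopped just then and those
  still running, and the martingale property takes \<open>S (Suc m)\<close> back to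
  \<open>S m\<close> on it. Measurability follows from the same recursion in \<open>m\<close>, so
  both claims share one induction.\<close>

lemma nn_integral_stopped_downtick:
  fixes k
  defines "V \<equiv> \<lambda>\<omega>. ennreal (stopped_value S (downtick S k) \<omega>)"
  assumes k: "k \<ge> 1"
  shows "(\<lambda>\<omega>. indicator {\<omega>. k \<le> downtick_count S m \<omega>} \<omega> * V \<omega>) \<in> borel_measurable P" (is "?W m \<in> _")
    and "(\<integral>\<^sup>+\<omega>. indicator {\<omega>. k \<le> downtick_count S m \<omega>} \<omega> * V \<omega> \<partial>P) +
      (\<integral>\<^sup>+\<omega>. indicator {\<omega>\<in>space P. downtick_count S m \<omega> < k} \<omega> * ennreal (S m \<omega>) \<partial>P) = ennreal x"
proof (induction m)
  case 0
  {
    case 1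
    show ?case using k by simp
  next
    case 2
    have "(\<integral>\<^sup>+\<omega>. indicator {\<omega>\<in>space P. downtick_count S 0 \<omega> < k} \<omega> * ennreal (S 0 \<omega>) \<partial>P) =
        (\<integral>\<^sup>+\<omega>. ennreal (S 0 \<omega>) \<partial>P)"
      using k by (intro nn_integral_cong) simp
    then show ?case using k by (simp add: nn_integral_S)
  }
next
  case (Suc m)
  let ?N = "downtick_count S"
  have [measurable]: "{\<omega>\<in>space P. ?N j \<omega> < k} \<in> sets P"
    "{\<omega>\<in>space P. ?N j \<omega> < k \<and> k \<le> ?N (Suc j) \<omega>} \<in> sets P" for j
  proof -
    have *: "{\<omega>\<in>space P. Q (?N i \<omega>)} \<in> sets P" for Q i
      by (rule sets_F_D[OF downtick_count_in_F])
    show "{\<omega>\<in>space P. ?N j \<omega> < k} \<in> sets P" by (rule *)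
    have "{\<omega>\<in>space P. ?N j \<omega> < k \<and> k \<le> ?N (Suc j) \<omega>} =
        {\<omega>\<in>space P. ?N j \<omega> < k} \<inter> {\<omega>\<in>space P. k \<le> ?N (Suc j) \<omega>}" by auto
    also have "\<dots> \<in> sets P" by (intro sets.Int *)
    finally show "{\<omega>\<in>space P. ?N j \<omega> < k \<and> k \<le> ?N (Suc j) \<omega>} \<in> sets P" .
  qed
  \<comment> \<open>The contribution of the paths whose \<open>k\<close>-th downtick is exactly at
    time \<open>Suc m\<close>, where \<open>stopped_value_downtick\<close> identifies the stopped
    value.\<close>
  let ?U = "\<lambda>\<omega>. indicator {\<omega>\<in>space P. ?N m \<omega> < k \<and> k \<le> ?N (Suc m) \<omega>} \<omega> * ennreal (S (Suc m) \<omega>)"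
  have W_Suc: "?W (Suc m) \<omega> = ?W m \<omega> + ?U \<omega>" if "\<omega> \<in> space P" for \<omega>
    using that downtick_count_mono[of m "Suc m" S \<omega>] stopped_value_downtick[of S m \<omega> k]
    by (auto simp: V_def not_le simp del: downtick_count_Suc split: split_indicator)
  note [measurable] = Suc(1)
  {
    case 1
    show ?case by (subst measurable_cong[OF W_Suc], assumption) measurable
  next
    case 2
    have "(\<integral>\<^sup>+\<omega>. ?W (Suc m) \<omega> \<partial>P) +
        (\<integral>\<^sup>+\<omega>. indicator {\<omega>\<in>space P. ?N (Suc m) \<omega> < k} \<omega> * ennreal (S (Suc m) \<omega>) \<partial>P) =
        (\<integral>\<^sup>+\<omega>. ?W m \<omega> \<partial>P) + ((\<integral>\<^sup>+\<omega>. ?U \<omega> \<partial>P) +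
        (\<integral>\<^sup>+\<omega>. indicator {\<omega>\<in>space P. ?N (Suc m) \<omega> < k} \<omega> * ennreal (S (Suc m) \<omega>) \<partial>P))"
      by (subst nn_integral_cong[OF W_Suc], assumption, subst nn_integral_add)
         (simp_all add: add.assoc del: downtick_count_Suc)
    also have "(\<integral>\<^sup>+\<omega>. ?U \<omega> \<partial>P) +
        (\<integral>\<^sup>+\<omega>. indicator {\<omega>\<in>space P. ?N (Suc m) \<omega> < k} \<omega> * ennreal (S (Suc m) \<omega>) \<partial>P) =
        (\<integral>\<^sup>+\<omega>. indicator {\<omega>\<in>space P. ?N m \<omega> < k} \<omega> * ennreal (S (Suc m) \<omega>) \<partial>P)"
      by (subst nn_integral_add[symmetric])
         (auto intro!: nn_integral_cong simp del: downtick_count_Suc split: split_indicator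
           simp: not_le dest: le_less_trans[OF downtick_count_mono[OF le_SucI[OF order_refl]]])
    also have "\<dots> = (\<integral>\<^sup>+\<omega>. indicator {\<omega>\<in>space P. ?N m \<omega> < k} \<omega> * ennreal (S m \<omega>) \<partial>P)"
      by (rule nn_integral_S_Suc[OF downtick_count_in_F])
    finally show ?case using Suc(2) by simp
  }
qed

end

section \<open>Consequences for the downtick times and the default function\<close>

context downtick_martingale
begin

text \<open>Makes every downtick time finite almost surely, so that the value of
  \<open>S_lim\<close> does not enter the expectations in \<open>bubble\<close>.\<close>

lemma AE_downtick_count_unbounded: "AE \<omega> in P. \<forall>k. \<exists>m. k \<le> downtick_count S m \<omega>"
proof -
  have "AE \<omega> in P. \<forall>n. \<exists>i\<ge>n. S (Suc i) \<omega> < S i \<omega>"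
    unfolding AE_all_countable using AE_downtick by simp
  then show ?thesis
  proof eventually_elim
    case (elim \<omega>)
    show ?case
    proof
      fix k show "\<exists>m. k \<le> downtick_count S m \<omega>"
      proof (induction k)
        case (Suc k)
        then obtain m where m: "k \<le> downtick_count S m \<omega>" ..
        obtain i where i: "i \<ge> m" "S (Suc i) \<omega> < S i \<omega>" using elim by blast
        then have "Suc k \<le> downtick_count S (Suc i) \<omega>"
          using m downtick_count_mono[OF i(1), of S \<omega>] by simp
        then show ?case ..
      qed simp
    qed
  qed
qed

text \<open>A path with a downtick leaves \<open>up 0 n\<close> for all large \<open>n\<close>, so
  the integrand is eventually 0 almost surely. It is dominated by
  \<open>\<bar>S_lim S \<omega>\<bar>\<close>.\<close>

lemma integral_S_lim_up: "(\<lambda>n. \<integral>\<omega>. indicator (up 0 n) \<omega> * S_lim S \<omega> \<partial>P) \<longlonglongrightarrow> 0"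
proof -
  note [measurable] = borel_measurable_integrable[OF integrable_S_lim]
  have "(\<lambda>n. \<integral>\<omega>. indicator (up 0 n) \<omega> * S_lim S \<omega> \<partial>P) \<longlonglongrightarrow> (\<integral>\<omega>. 0 \<partial>P)"
  proof (rule integral_dominated_convergence[where w="\<lambda>\<omega>. \<bar>S_lim S \<omega>\<bar>"])
    show "AE \<omega> in P. (\<lambda>n. indicator (up 0 n) \<omega> * S_lim S \<omega>) \<longlonglongrightarrow> 0"
      using AE_downtick[of 0]
    proof eventually_elim
      case (elim \<omega>)
      then obtain i where i: "S (Suc i) \<omega> < S i \<omega>" by blast
      have "eventually (\<lambda>n. indicator (up 0 n) \<omega> * S_lim S \<omega> = 0) sequentially"
        using eventually_gt_at_top[of i]
        by eventually_elim (use i in \<open>force simp: up_def split: split_indicator\<close>)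
      then show ?case by (rule tendsto_eventually)
    qed
  qed (auto intro!: integrable_abs integrable_S_lim split: split_indicator)
  then show ?thesis by simp
qed

text \<open>The sequence is nonnegative and, by the martingale property, nonincreasing, hence
  convergent. From \<open>n = 1\<close> on it differs from the one in \<open>default_fun\<close> by
  the term that vanishes by \<open>integral_S_lim_up\<close>. The constant family is harmless since
  \<open>default_fun\<close> evaluates its family only at \<open>x\<close>.\<close>

lemma default_fun_lim:
  "(\<lambda>n. \<integral>\<omega>. indicator (up 0 n) \<omega> * S n \<omega> \<partial>P) \<longlonglongrightarrow> default_fun (\<lambda>_. P) S x"
proof -
  define u where "u n = (\<integral>\<omega>. indicator (up 0 n) \<omega> * S n \<omega> \<partial>P)" for n
  note [measurable] = borel_measurable_integrable[OF integrable_S_lim]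
  have int: "integrable P (\<lambda>\<omega>. indicator (up 0 n) \<omega> * S k \<omega>)" for n k
    using integrable_mult_indicator[OF up_in_sets integrable_S] by simp
  have nn: "ennreal (\<integral>\<omega>. indicator (up 0 n) \<omega> * S k \<omega> \<partial>P) =
      (\<integral>\<^sup>+\<omega>. indicator (up 0 n) \<omega> * ennreal (S k \<omega>) \<partial>P)" for n k
    by (subst nn_integral_eq_integral[OF int, symmetric])
       (auto intro!: AE_I2 nn_integral_cong less_imp_le[OF S_pos] split: split_indicator)
  have u_nonneg: "u n \<ge> 0" for n
    unfolding u_def by (intro integral_nonneg_AE AE_I2) (auto simp: less_imp_le[OF S_pos])
  have "u (Suc n) \<le> u n" for n
  proof -
    have "ennreal (u (Suc n)) = (\<integral>\<^sup>+\<omega>. indicator (up 0 (Suc n)) \<omega> * ennreal (S (Suc n) \<omega>) \<partial>P)"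
      unfolding u_def by (rule nn)
    also have "\<dots> \<le> (\<integral>\<^sup>+\<omega>. indicator (up 0 n) \<omega> * ennreal (S (Suc n) \<omega>) \<partial>P)"
      by (intro nn_integral_mono) (auto simp: up_Suc split: split_indicator)
    also have "\<dots> = ennreal (u n)"
      unfolding u_def nn by (rule nn_integral_S_Suc[OF up_in_F])
    finally show ?thesis using u_nonneg by simp
  qed
  then have "decseq u" by (rule decseq_SucI)
  then obtain L where L: "u \<longlonglongrightarrow> L"
    using decseq_convergent[of u 0] u_nonneg by blast
  let ?v = "\<lambda>n. \<integral>\<omega>. (S n \<omega> - S_lim S \<omega>) *
    indicator {\<omega>. x \<le> S 1 \<omega> \<and> (\<forall>i\<in>{1..<n}. S i \<omega> \<le> S (Suc i) \<omega>)} \<omega> \<partial>P"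
  \<comment> \<open>At \<open>n = 0\<close> the events differ: \<open>up 0 0\<close> is the whole
    space, while the event in \<open>default_fun\<close> still demands
    \<open>x \<le> S 1 \<omega>\<close>.\<close>
  have v_eq: "?v n = u n - (\<integral>\<omega>. indicator (up 0 n) \<omega> * S_lim S \<omega> \<partial>P)" if "n \<ge> 1" for n
  proof -
    have "?v n = (\<integral>\<omega>. indicator (up 0 n) \<omega> * S n \<omega> - indicator (up 0 n) \<omega> * S_lim S \<omega> \<partial>P)"
    proof (rule integral_cong_AE)
      show "AE \<omega> in P. (S n \<omega> - S_lim S \<omega>) *
          indicator {\<omega>. x \<le> S 1 \<omega> \<and> (\<forall>i\<in>{1..<n}. S i \<omega> \<le> S (Suc i) \<omega>)} \<omega> =
          indicator (up 0 n) \<omega> * S n \<omega> - indicator (up 0 n) \<omega> * S_lim S \<omega>"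
        using S_0 AE_space
      proof eventually_elim
        case (elim \<omega>)
        have "{0..<n} = insert 0 {1..<n}" using that by auto
        then have "\<omega> \<in> up 0 n \<longleftrightarrow> x \<le> S 1 \<omega> \<and> (\<forall>i\<in>{1..<n}. S i \<omega> \<le> S (Suc i) \<omega>)"
          using elim by (simp add: up_def)
        then show ?case by (simp add: indicator_def)
      qed
    qed measurable
    also have "\<dots> = u n - (\<integral>\<omega>. indicator (up 0 n) \<omega> * S_lim S \<omega> \<partial>P)"
      unfolding u_def
      using integrable_mult_indicator[OF up_in_sets integrable_S_lim]
      by (intro Bochner_Integration.integral_diff int) simp
    finally show ?thesis .
  qed
  have "eventually (\<lambda>n. u n - (\<integral>\<omega>. indicator (up 0 n) \<omega> * S_lim S \<omega> \<partial>P) = ?v n) sequentially"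
    by (rule eventually_sequentiallyI[of 1]) (rule v_eq[symmetric])
  moreover have "(\<lambda>n. u n - (\<integral>\<omega>. indicator (up 0 n) \<omega> * S_lim S \<omega> \<partial>P)) \<longlonglongrightarrow> L"
    using tendsto_diff[OF L integral_S_lim_up] by simp
  ultimately have "?v \<longlonglongrightarrow> L" by (rule Lim_transform_eventually[rotated])
  then have "default_fun (\<lambda>_. P) S x = L"
    unfolding default_fun_def by (rule limI)
  with L show ?thesis by (simp add: u_def[abs_def])
qed

end

section \<open>Comparison with \<open>M\<close> and the bubble property\<close>

locale sub_default = downtick_martingale +
  fixes M :: "real \<Rightarrow> real"
  assumes M_meas: "M \<in> borel_measurable pos_borel"
    and M_nonneg: "\<And>y. y > 0 \<Longrightarrow> 0 \<le> M y"
    and M_le: "\<And>y. y > 0 \<Longrightarrow> M y \<le> y"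
    and M_sub: "\<And>y. y > 0 \<Longrightarrow> M y \<le> (LINT z:{y..}|K y. M z)"
begin

text \<open>For a nonnegative integrand the Bochner integral is \<open>enn2real\<close> of the
  nonnegative integral and so never exceeds it, even if the latter is infinite.\<close>

lemma M_sub_nn:
  assumes y: "y > 0"
  shows "ennreal (M y) \<le> (\<integral>\<^sup>+z. indicator {y..} z * ennreal (M z) \<partial>K y)"
proof -
  have m: "(\<lambda>z. indicator {y..} z * M z) \<in> borel_measurable (K y)"
    using M_meas by (subst measurable_cong_sets[OF sets_K[OF y] refl]) simp
  have "ennreal (M y) \<le> ennreal (\<integral>z. indicator {y..} z * M z \<partial>K y)"
    using M_sub[OF y] by (intro ennreal_leI) (simp add: set_lebesgue_integral_def)
  also have "\<dots> \<le> (\<integral>\<^sup>+z. ennreal (indicator {y..} z * M z) \<partial>K y)"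
    using y M_nonneg m by (subst integral_eq_nn_integral)
      (auto intro!: AE_I2 simp: space_K ennreal_enn2real_if split: split_indicator)
  also have "\<dots> = (\<integral>\<^sup>+z. indicator {y..} z * ennreal (M z) \<partial>K y)"
    by (intro nn_integral_cong) (auto split: split_indicator)
  finally show ?thesis .
qed

text \<open>Iterate the inequality for \<open>M\<close> up to time \<open>m\<close>, then use
  \<open>M y \<le> y\<close> to trade \<open>M\<close> for the process itself, which the martingale
  property controls.\<close>

lemma nn_integral_M_le_up:
  assumes B: "B \<in> sets (F n)" and "n \<le> m"
  shows "(\<integral>\<^sup>+\<omega>. indicator B \<omega> * ennreal (M (S n \<omega>)) \<partial>P) \<le>
    (\<integral>\<^sup>+\<omega>. indicator (B \<inter> up n m) \<omega> * ennreal (S m \<omega>) \<partial>P)"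
proof -
  note [measurable] = M_meas
  have "(\<integral>\<^sup>+\<omega>. indicator B \<omega> * ennreal (M (S n \<omega>)) \<partial>P) \<le>
      (\<integral>\<^sup>+\<omega>. indicator (B \<inter> up n m) \<omega> * ennreal (M (S m \<omega>)) \<partial>P)"
    by (rule nn_integral_le_up[OF _ M_sub_nn assms]) simp_all
  also have "\<dots> \<le> (\<integral>\<^sup>+\<omega>. indicator (B \<inter> up n m) \<omega> * ennreal (S m \<omega>) \<partial>P)"
    by (intro nn_integral_mono mult_left_mono ennreal_leI M_le S_pos) auto
  finally show ?thesis .
qed

lemma M_le_default_fun: "M x \<le> default_fun (\<lambda>_. P) S x"
proof (rule LIMSEQ_le_const[OF default_fun_lim], intro exI allI impI)
  fix n
  have int: "integrable P (\<lambda>\<omega>. indicator (up 0 n) \<omega> * S n \<omega>)"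
    using integrable_mult_indicator[OF up_in_sets integrable_S] by simp
  have "ennreal (M x) = (\<integral>\<^sup>+\<omega>. ennreal (M x) \<partial>P)" by (simp add: emeasure_space_1)
  also have "\<dots> = (\<integral>\<^sup>+\<omega>. indicator (space P) \<omega> * ennreal (M (S 0 \<omega>)) \<partial>P)"
    using S_0 AE_space by (intro nn_integral_cong_AE) auto
  also have "\<dots> \<le> (\<integral>\<^sup>+\<omega>. indicator (space P \<inter> up 0 n) \<omega> * ennreal (S n \<omega>) \<partial>P)"
    using sets.top[of "F 0"] by (intro nn_integral_M_le_up) simp_all
  also have "\<dots> = (\<integral>\<^sup>+\<omega>. ennreal (indicator (up 0 n) \<omega> * S n \<omega>) \<partial>P)"
    by (intro nn_integral_cong) (auto split: split_indicator)
  also have "\<dots> = ennreal (\<integral>\<omega>. indicator (up 0 n) \<omega> * S n \<omega> \<partial>P)"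
    by (intro nn_integral_eq_integral int) (auto intro!: AE_I2 simp: less_imp_le[OF S_pos])
  finally show "M x \<le> (\<integral>\<omega>. indicator (up 0 n) \<omega> * S n \<omega> \<partial>P)"
    by (subst (asm) ennreal_le_iff) (auto intro!: integral_nonneg_AE AE_I2 simp: less_imp_le[OF S_pos])
qed

text \<open>At every time \<open>m \<ge> n\<close> the paths still waiting for their
  \<open>k\<close>-th downtick carry expectation at least \<open>h\<close>. Almost surely each path
  is eventually stopped, so this mass is lost in the limit and Fatou's lemma leaves at most
  \<open>x - h\<close> for the stopped value.\<close>

lemma bubble_if_unbounded:
  assumes lim: "Liminf at_top (\<lambda>y. ereal (M y)) > 0" and unb: "\<not> as_bounded P S"
  shows "bubble P S x"
proof -
  let ?N = "downtick_count S"
  obtain d where d: "d > 0" "ereal d < Liminf at_top (\<lambda>y. ereal (M y))"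
    using ereal_dense2[OF lim] by (auto simp: zero_ereal_def)
  from less_LiminfD[OF d(2)] obtain C where C: "\<And>y. y \<ge> C \<Longrightarrow> d < M y"
    by (auto simp: eventually_at_top_linorder)
  \<comment> \<open>If all these countably many events were null, \<open>C\<close> would bound the
    process almost surely. Fixing the count \<open>c\<close> as well makes the index
    \<open>k\<close> deterministic.\<close>
  have "\<exists>n c. \<not> (AE \<omega> in P. \<not> (C < S n \<omega> \<and> ?N n \<omega> = c))"
  proof (rule ccontr)
    assume "\<not> ?thesis"
    then have "AE \<omega> in P. \<forall>n c. \<not> (C < S n \<omega> \<and> ?N n \<omega> = c)"
      unfolding AE_all_countable by blast
    then have "AE \<omega> in P. \<forall>n. S n \<omega> \<le> C" by eventually_elim (auto simp: not_less)
    with unb show False by (auto simp: as_bounded_def)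
  qed
  then obtain n c where nc: "\<not> (AE \<omega> in P. \<not> (C < S n \<omega> \<and> ?N n \<omega> = c))" by blast
  define B where "B = {\<omega>\<in>space P. C < S n \<omega>} \<inter> {\<omega>\<in>space P. ?N n \<omega> = c}"
  define k where "k = Suc c"
  have B: "B \<in> sets (F n)"
  proof -
    have "Measurable.pred (F n) (\<lambda>\<omega>. C < S n \<omega>)"
      using S_measurable_F[of n n] by simp
    then show ?thesis
      unfolding B_def using downtick_count_in_F[of "\<lambda>i. i = c" n] by (auto simp: pred_def)
  qed
  have "emeasure P B \<noteq> 0"
  proof
    assume "emeasure P B = 0"
    then have "AE \<omega> in P. \<omega> \<notin> B" using sets_F_D[OF B] by (intro AE_not_in) auto
    then have "AE \<omega> in P. \<not> (C < S n \<omega> \<and> ?N n \<omega> = c)"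
      using AE_space by eventually_elim (auto simp: B_def)
    with nc show False by simp
  qed
  define h where "h = ennreal d * emeasure P B"
  have h: "h > 0"
    using d(1) \<open>emeasure P B \<noteq> 0\<close>
    by (simp add: h_def ennreal_zero_less_mult_iff zero_less_iff_neq_zero)
  let ?V = "\<lambda>\<omega>. ennreal (stopped_value S (downtick S k) \<omega>)"
  let ?W = "\<lambda>m \<omega>. indicator {\<omega>. k \<le> ?N m \<omega>} \<omega> * ?V \<omega>"
  have k1: "k \<ge> 1" by (simp add: k_def)
  have W_le: "(\<integral>\<^sup>+\<omega>. ?W m \<omega> \<partial>P) \<le> ennreal x - h" if "n \<le> m" for m
  proof -
    let ?R = "\<integral>\<^sup>+\<omega>. indicator {\<omega>\<in>space P. ?N m \<omega> < k} \<omega> * ennreal (S m \<omega>) \<partial>P"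
    have "h = (\<integral>\<^sup>+\<omega>. ennreal d * indicator B \<omega> \<partial>P)"
      using sets_F_D[OF B] by (simp add: h_def nn_integral_cmult)
    also have "\<dots> \<le> (\<integral>\<^sup>+\<omega>. indicator B \<omega> * ennreal (M (S n \<omega>)) \<partial>P)"
      using C by (intro nn_integral_mono)
        (auto simp: B_def intro!: ennreal_leI intro: less_imp_le split: split_indicator)
    also have "\<dots> \<le> (\<integral>\<^sup>+\<omega>. indicator (B \<inter> up n m) \<omega> * ennreal (S m \<omega>) \<partial>P)"
      by (rule nn_integral_M_le_up[OF B that])
    \<comment> \<open>On \<open>up n m\<close> the count keeps its value \<open>c < k\<close> from
      time \<open>n\<close>.\<close>
    also have "\<dots> \<le> ?R"
      using downtick_count_up[OF _ that]
      by (intro nn_integral_mono) (auto simp: B_def k_def split: split_indicator)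
    finally have "h \<le> ?R" .
    have eq: "(\<integral>\<^sup>+\<omega>. ?W m \<omega> \<partial>P) + ?R = ennreal x"
      by (rule nn_integral_stopped_downtick(2)[OF k1])
    \<comment> \<open>Finiteness is what allows cancelling \<open>?R\<close> in
      \<open>ennreal\<close>.\<close>
    then have "?R \<noteq> \<top>" by auto
    then have "(\<integral>\<^sup>+\<omega>. ?W m \<omega> \<partial>P) = ennreal x - ?R"
      unfolding eq[symmetric] by simp
    also have "\<dots> \<le> ennreal x - h" using \<open>h \<le> ?R\<close> by (rule ennreal_minus_mono[OF order_refl])
    finally show ?thesis .
  qed
  \<comment> \<open>Once the count has reached \<open>k\<close>, \<open>?W m\<close> equals
    \<open>?V\<close>. Fatou's lemma is applied to the \<open>?W m\<close>, whose measurability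
    comes from \<open>nn_integral_stopped_downtick\<close>.\<close>
  have "(\<integral>\<^sup>+\<omega>. ?V \<omega> \<partial>P) \<le> (\<integral>\<^sup>+\<omega>. liminf (\<lambda>m. ?W m \<omega>) \<partial>P)"
  proof (rule nn_integral_mono_AE)
    show "AE \<omega> in P. ?V \<omega> \<le> liminf (\<lambda>m. ?W m \<omega>)"
      using AE_downtick_count_unbounded
    proof eventually_elim
      case (elim \<omega>)
      then obtain m where m: "k \<le> ?N m \<omega>" by blast
      have "eventually (\<lambda>j. ?V \<omega> \<le> ?W j \<omega>) sequentially"
        using eventually_ge_at_top[of m]
      proof eventually_elim
        case (elim j)
        then show ?case using order_trans[OF m downtick_count_mono[OF elim]] by simp
      qed
      then show ?case by (rule Liminf_bounded)
    qed
  qed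
  also have "\<dots> \<le> liminf (\<lambda>m. \<integral>\<^sup>+\<omega>. ?W m \<omega> \<partial>P)"
    by (intro nn_integral_liminf nn_integral_stopped_downtick(1) k1)
  also have "\<dots> \<le> liminf (\<lambda>m::nat. ennreal x - h)"
    by (intro Liminf_mono eventually_sequentiallyI[of n] W_le)
  also have "\<dots> = ennreal x - h" by (simp add: Liminf_const)
  also have "\<dots> < ennreal x"
    using h x_pos by (intro ennreal_between) auto
  finally show ?thesis unfolding bubble_def using k1 by blast
qed

end

theorem corollary3p10:
  fixes K :: "real \<Rightarrow> real measure"
    and P :: "real \<Rightarrow> 'w measure"
    and S :: "nat \<Rightarrow> 'w \<Rightarrow> real"
    and M :: "real \<Rightarrow> real"
  assumes kernel: "martingale_kernel K"
    and chain: "\<And>x. x > 0 \<Longrightarrow> markov_chain_from K x (P x) S"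
    and down_prob: "\<And>x\<^sub>a y. 0 < x\<^sub>a \<Longrightarrow> x\<^sub>a < y \<Longrightarrow> (INF x\<in>{x\<^sub>a..y}. measure (K x) {0<..<x}) > 0"
    and M_meas: "M \<in> borel_measurable pos_borel"
    and M_nonneg: "\<And>x. x > 0 \<Longrightarrow> 0 \<le> M x"
    and M_le: "\<And>x. x > 0 \<Longrightarrow> M x \<le> x"
    and M_sub: "\<And>x. x > 0 \<Longrightarrow> M x \<le> (LINT y:{x..}|K x. M y)"
  shows "(\<forall>x>0. M x \<le> default_fun P S x) \<and>
         (Liminf at_top (\<lambda>x. ereal (M x)) > 0 \<longrightarrow>
            (\<forall>x>0. \<not> as_bounded (P x) S \<longrightarrow> bubble (P x) S x))"
proof -
  have sub_default: "sub_default K x (P x) S M" if x: "x > 0" for x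
  proof -
    have "prob_space (P x)" using chain[OF x] by (simp add: markov_chain_from_def)
    then show ?thesis
      using x kernel chain[OF x] down_prob M_meas M_nonneg M_le M_sub
      by (intro sub_default.intro downtick_martingale.intro markov_martingale.intro
          markov_martingale_axioms.intro downtick_martingale_axioms.intro sub_default_axioms.intro)
  qed
  \<comment> \<open>Unfolding replaces the constant family of the locale by \<open>P\<close>, both
    being evaluated at \<open>x\<close> only.\<close>
  have "M x \<le> default_fun P S x" if "x > 0" for x
    using sub_default.M_le_default_fun[OF sub_default[OF that]] by (simp add: default_fun_def)
  then show ?thesis
    using sub_default.bubble_if_unbounded[OF sub_default] by blast
qed

end
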